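(* The signed Zarankiewicz number $z_{SL}$ and the recursive-line Zarankiewicz number $z_{RL}$ satisfy $z_{SL}(15,6)=z_{RL}(15,6)=60$.
   Context: **Grids.** Let $m,n\ge 2$ and let the cells be the elements $(i,j)$ of $\{1,\dots,m\}\times\{1,\dots,n\}$ ($i$ is the row, $j$ the column). A grid consists of a set $E_1$ of cells (the one-edges) and a set $E_2$ of unordered pairs of distinct cells (the two-edges, or double edges). The selected edges are the elements of $E_1$ and of $E_2$; a one-edge occupies one cell, a two-edge occupies its two cells. The grid is simple if every cell is occupied by at most one selected edge. Cells occupied by no selected edge are empty. A two-edge may have its two cells in the same row (row-degenerate), in the same column (column-degenerate), or in different rows and different columns (diagonal). The total of the grid is $N=|E_1|+|E_2|$ (a two-edge counts once). A simple grid corresponds to the doubly simple biquadratic form $\sum_{(i,j)\in E_1}x_i^2y_j^2+\sum_{\{(i,j),(k,l)\}\in E_2}(x_iy_j+x_ky_l)^2$. **Zarankiewicz number.** $z(m,n)$ is the maximum number of ones in an $m\times n$ binary matrix with no all-one $2\times2$ submatrix. A grid is limited if $|E_1|=z(m,n)$. **Rectangles.** For rows $i\neq k$ and columns $j\ne l$, the rectangle on these rows and columns has the two diagonals $\{(i,j),(k,l)\}$ and $\{(i,l),(k,j)\}$. **Certification $(\mathrm{RW}3^+)$.** For a simple grid, let $I\subseteq E_2$ (the identified two-edges) and $Z$ (a set of unordered pairs of distinct cells, the certified orthogonal pairs) be the smallest sets closed under the following rules. (1) Every pair containing an empty cell is in $Z$. (2) Line rule: if two distinct cells lie in the same row or the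 same column, then the pair is in $I$ if it is a two-edge, and is in $Z$ otherwise. (3) Complementary-pair rule: if both diagonals of a rectangle are two-edges, both are in $I$. (4) Rectangle transfer: if neither diagonal of a rectangle is a two-edge and one diagonal is in $Z$, then the other is in $Z$. If exactly one diagonal $d$ of a rectangle is a two-edge and $d'$ is the other diagonal, then $d'\in Z$ implies $d\in I$, and $d\in I$ implies $d'\in Z$. (5) Saturation: if $\{a,a'\}\in I$, $c\notin\{a,a'\}$ and $\{a,c\}\in Z$, then $\{a',c\}\in Z$. The grid satisfies $(\mathrm{RW}3^+)$ if $I=E_2$ and, for every two distinct selected edges $e,f$, all pairs consisting of a cell of $e$ and a cell of $f$ are in $Z$. (Identification only glues the two halves of a single two-edge, so distinct selected edges give distinct classes.) **Recursive-line Zarankiewicz number.** $z_{RL}(m,n)$ is the maximum of $|E_1|+|E_2|$ over all simple, limited $m\times n$ grids satisfying $(\mathrm{RW}3^+)$. **Signed certification $(\mathrm{RW}3^\pm)$.** This is defined in the same way as $(\mathrm{RW}3^+)$, with $I$ and $Z$ the smallest sets closed under rules (1)–(5) and the additional rule (6): consider the signed graph whose vertices are the unordered pairs of distinct cells, with a negative edge joining the two diagonals of each rectangle neither of whose diagonals is a two-edge, and a positive edge joining $\{a,c\}$ and $\{a',c\}$ whenever $\{a,a'\}\in I$ and $c\notin\{a,a'\}$; if a vertex $p$ lies on a closed walk containing an odd number of negative edges (counted with multiplicity), then $p\in Z$. **Signed Zarankiewicz number.** $z_{SL}(m,n)$ is the maximum of $|E_1|+|E_2|$ over all simple, limited $m\times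 n$ grids satisfying $(\mathrm{RW}3^\pm)$. *)

theory Defs
  imports Main
begin

type_synonym cell = "nat \<times> nat"

definition cells :: "nat \<Rightarrow> nat \<Rightarrow> cell set" where
  "cells m n = {1..m} \<times> {1..n}"

definition cell_pairs :: "nat \<Rightarrow> nat \<Rightarrow> cell set set" where
  "cell_pairs m n = {{a, b} |a b. a \<in> cells m n \<and> b \<in> cells m n \<and> a \<noteq> b}"

definition is_grid :: "nat \<Rightarrow> nat \<Rightarrow> cell set \<Rightarrow> cell set set \<Rightarrow> bool" where
  "is_grid m n E1 E2 \<longleftrightarrow> E1 \<subseteq> cells m n \<and> E2 \<subseteq> cell_pairs m n"

text \<open>A selected edge is represented by the set of cells it occupies. As two-edges consist of two
  distinct cells, the one-edges (singletons) and the two-edges stay apart.\<close>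

definition selected_edges :: "cell set \<Rightarrow> cell set set \<Rightarrow> cell set set" where
  "selected_edges E1 E2 = (\<lambda>c. {c}) ` E1 \<union> E2"

definition simple_grid :: "nat \<Rightarrow> nat \<Rightarrow> cell set \<Rightarrow> cell set set \<Rightarrow> bool" where
  "simple_grid m n E1 E2 \<longleftrightarrow> is_grid m n E1 E2 \<and>
     (\<forall>c \<in> cells m n. \<forall>e \<in> selected_edges E1 E2. \<forall>f \<in> selected_edges E1 E2.
        c \<in> e \<longrightarrow> c \<in> f \<longrightarrow> e = f)"

definition rectangle_free :: "nat \<Rightarrow> nat \<Rightarrow> (nat \<Rightarrow> nat \<Rightarrow> bool) \<Rightarrow> bool" where
  "rectangle_free m n A \<longleftrightarrow>
     \<not> (\<exists>i \<in> {1..m}. \<exists>k \<in> {1..m}. \<exists>j \<in> {1..n}. \<exists>l \<in> {1..n}.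
          i \<noteq> k \<and> j \<noteq> l \<and> A i j \<and> A i l \<and> A k j \<and> A k l)"

definition zarankiewicz :: "nat \<Rightarrow> nat \<Rightarrow> nat" where
  "zarankiewicz m n = Max {card {(i, j). (i, j) \<in> cells m n \<and> A i j} |A. rectangle_free m n A}"

lemma finite_nonempty_zarankiewicz:
  "finite {card {(i, j). (i, j) \<in> cells m n \<and> A i j} |A. rectangle_free m n A}"
  "{card {(i, j). (i, j) \<in> cells m n \<and> A i j} |A. rectangle_free m n A} \<noteq> {}"
proof -
  have fin: "finite (cells m n)" by (simp add: cells_def)
  have "{card {(i, j). (i, j) \<in> cells m n \<and> A i j} |A. rectangle_free m n A} \<subseteq> card ` Pow (cells m n)"
    by blast
  then show "finite {card {(i, j). (i, j) \<in> cells m n \<and> A i j} |A. rectangle_free m n A}"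
    by (rule finite_subset) (simp add: fin)
  have "rectangle_free m n (\<lambda>i j. False)" by (simp add: rectangle_free_def)
  then show "{card {(i, j). (i, j) \<in> cells m n \<and> A i j} |A. rectangle_free m n A} \<noteq> {}" by blast
qed

definition limited_grid :: "nat \<Rightarrow> nat \<Rightarrow> cell set \<Rightarrow> bool" where
  "limited_grid m n E1 \<longleftrightarrow> card E1 = zarankiewicz m n"

definition opposite_diagonals :: "nat \<Rightarrow> nat \<Rightarrow> cell set \<Rightarrow> cell set \<Rightarrow> bool" where
  "opposite_diagonals m n d d' \<longleftrightarrow>
     (\<exists>i \<in> {1..m}. \<exists>k \<in> {1..m}. \<exists>j \<in> {1..n}. \<exists>l \<in> {1..n}.
        i \<noteq> k \<and> j \<noteq> l \<and> d = {(i, j), (k, l)} \<and> d' = {(i, l), (k, j)})"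

lemma opposite_diagonals_sym: "opposite_diagonals m n d d' \<Longrightarrow> opposite_diagonals m n d' d"
  unfolding opposite_diagonals_def by metis

text \<open>\<open>signed_walk m n E2 I p q k\<close>: the signed graph determined by the two-edges \<open>E2\<close> and the
  identified pairs \<open>I\<close> has a walk from \<open>p\<close> to \<open>q\<close> with exactly \<open>k\<close> negative edges, counted with
  multiplicity.\<close>

inductive signed_walk ::
  "nat \<Rightarrow> nat \<Rightarrow> cell set set \<Rightarrow> (cell set \<Rightarrow> bool) \<Rightarrow> cell set \<Rightarrow> cell set \<Rightarrow> nat \<Rightarrow> bool"
  for m n E2 I
where
  start: "p \<in> cell_pairs m n \<Longrightarrow> signed_walk m n E2 I p p 0"
| negative: "\<lbrakk>signed_walk m n E2 I p d k; opposite_diagonals m n d d'; d \<notin> E2; d' \<notin> E2\<rbrakk>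
    \<Longrightarrow> signed_walk m n E2 I p d' (Suc k)"
| positive: "\<lbrakk>signed_walk m n E2 I p {a, c} k; I {a, a'}; c \<notin> {a, a'}\<rbrakk>
    \<Longrightarrow> signed_walk m n E2 I p {a', c} k"

lemma signed_walk_mono [mono]:
  assumes "\<And>p. I p \<longrightarrow> J p"
  shows "signed_walk m n E2 I p q k \<longrightarrow> signed_walk m n E2 J p q k"
proof
  assume "signed_walk m n E2 I p q k"
  then show "signed_walk m n E2 J p q k"
    by induction (use assms in \<open>blast intro: signed_walk.intros\<close>)+
qed

text \<open>\<open>identified signed m n E1 E2\<close> and \<open>certified signed m n E1 E2\<close> are the sets \<open>I\<close> and \<open>Z\<close>, written as
  predicates. The flag \<open>signed\<close> switches the rule on closed walks: \<open>False\<close> gives \<open>RW3\<^sup>+\<close> and \<open>True\<close>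
  gives the signed variant. A closed walk through \<open>p\<close> may be taken to start and end at \<open>p\<close>.\<close>

inductive identified :: "bool \<Rightarrow> nat \<Rightarrow> nat \<Rightarrow> cell set \<Rightarrow> cell set set \<Rightarrow> cell set \<Rightarrow> bool"
  and certified :: "bool \<Rightarrow> nat \<Rightarrow> nat \<Rightarrow> cell set \<Rightarrow> cell set set \<Rightarrow> cell set \<Rightarrow> bool"
  for signed m n E1 E2
where
  empty_cell: "\<lbrakk>p \<in> cell_pairs m n; c \<in> p; c \<notin> \<Union> (selected_edges E1 E2)\<rbrakk>
    \<Longrightarrow> certified signed m n E1 E2 p"
| line_identified: "\<lbrakk>a \<in> cells m n; b \<in> cells m n; a \<noteq> b; fst a = fst b \<or> snd a = snd b;
      {a, b} \<in> E2\<rbrakk>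
    \<Longrightarrow> identified signed m n E1 E2 {a, b}"
| line_certified: "\<lbrakk>a \<in> cells m n; b \<in> cells m n; a \<noteq> b; fst a = fst b \<or> snd a = snd b;
      {a, b} \<notin> E2\<rbrakk>
    \<Longrightarrow> certified signed m n E1 E2 {a, b}"
| complementary: "\<lbrakk>opposite_diagonals m n d d'; d \<in> E2; d' \<in> E2\<rbrakk>
    \<Longrightarrow> identified signed m n E1 E2 d"
| transfer_none: "\<lbrakk>opposite_diagonals m n d d'; d \<notin> E2; d' \<notin> E2; certified signed m n E1 E2 d\<rbrakk>
    \<Longrightarrow> certified signed m n E1 E2 d'"
| transfer_identified: "\<lbrakk>opposite_diagonals m n d d'; d \<in> E2; d' \<notin> E2; certified signed m n E1 E2 d'\<rbrakk>
    \<Longrightarrow> identified signed m n E1 E2 d"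
| transfer_certified: "\<lbrakk>opposite_diagonals m n d d'; d \<in> E2; d' \<notin> E2; identified signed m n E1 E2 d\<rbrakk>
    \<Longrightarrow> certified signed m n E1 E2 d'"
| saturation: "\<lbrakk>identified signed m n E1 E2 {a, a'}; c \<notin> {a, a'}; certified signed m n E1 E2 {a, c}\<rbrakk>
    \<Longrightarrow> certified signed m n E1 E2 {a', c}"
| odd_closed_walk: "\<lbrakk>signed; signed_walk m n E2 (identified signed m n E1 E2) p p k; odd k\<rbrakk>
    \<Longrightarrow> certified signed m n E1 E2 p"

definition satisfies_RW3 :: "bool \<Rightarrow> nat \<Rightarrow> nat \<Rightarrow> cell set \<Rightarrow> cell set set \<Rightarrow> bool" where
  "satisfies_RW3 signed m n E1 E2 \<longleftrightarrow>
     {p. identified signed m n E1 E2 p} = E2 \<and>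
     (\<forall>e \<in> selected_edges E1 E2. \<forall>f \<in> selected_edges E1 E2. e \<noteq> f \<longrightarrow>
        (\<forall>a \<in> e. \<forall>b \<in> f. certified signed m n E1 E2 {a, b}))"

abbreviation "RW3_plus \<equiv> satisfies_RW3 False"
abbreviation "RW3_pm \<equiv> satisfies_RW3 True"

lemma finite_totals:
  "finite {card E1 + card E2 |E1 E2. simple_grid m n E1 E2 \<and> P E1 E2}"
proof -
  have fin: "finite (cells m n)" by (simp add: cells_def)
  have "cell_pairs m n \<subseteq> Pow (cells m n)" by (auto simp: cell_pairs_def)
  then have fin2: "finite (cell_pairs m n)" using fin by (simp add: finite_subset)
  have "{card E1 + card E2 |E1 E2. simple_grid m n E1 E2 \<and> P E1 E2}
      \<subseteq> (\<lambda>(E1, E2). card E1 + card E2) ` (Pow (cells m n) \<times> Pow (cell_pairs m n))"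
    by (force simp: simple_grid_def is_grid_def)
  then show ?thesis by (rule finite_subset) (simp add: fin fin2)
qed

definition z_RL :: "nat \<Rightarrow> nat \<Rightarrow> nat" where
  "z_RL m n = Max {card E1 + card E2 |E1 E2.
     simple_grid m n E1 E2 \<and> limited_grid m n E1 \<and> RW3_plus m n E1 E2}"

definition z_SL :: "nat \<Rightarrow> nat \<Rightarrow> nat" where
  "z_SL m n = Max {card E1 + card E2 |E1 E2.
     simple_grid m n E1 E2 \<and> limited_grid m n E1 \<and> RW3_pm m n E1 E2}"

end

theory Submission
  imports Defs
begin

text \<open>
  The upper bound is counting. In a rectangle-free \<open>15 \<times> 6\<close> matrix the 15 pairs of columns are each
  used by at most one row, and a row with \<open>k\<close> ones uses \<open>k choose 2 \<ge> k - 1\<close> of them; hence there are at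
  most \<open>15 + 15 = 30\<close> ones. The incidence matrix of the complete graph on six vertices attains
  this, so a limited grid has 30 one-edges. They leave \<open>90 - 30 = 60\<close> cells, hence room for at
  most 30 two-edges, and the total is at most 60.

  Equality therefore asks for a perfect matching of the 60 cells outside an incidence matrix of the
  complete graph for which the closure rules certify every pair of cells that is not itself a
  two-edge. A simple grid with no empty cell is the same thing as an involution of the cells: its fixed
  points are the one-edges and its orbits of length two are the two-edges. Each rule that
  derives a certified pair from a certified pair has only one such premise, so once all
  two-edges are identified, certification is reachability: a pair is certified if it can be moved to a
  pair on a line by exchanging the diagonals of rectangles and by replacing cells by their partners
  (\<open>certified_if_reaches_line\<close>). A certificate for the grid is a path of such moves for every pair.

  The chosen matching is invariant under a rotation of order five of the complete graph, with
  vertices \<open>0, \<dots>, 4\<close> and a fixed vertex \<open>\<infinity>\<close>. The rotation also acts on paths, so that 21 of the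
  105 pairs of rows suffice. Of the 30 two-edges, 25 lie on a line and are identified at the start. The
  other five form one orbit of diagonal two-edges; the opposite diagonal of one of
  them is certified by a path that replaces only cells of the 25 degenerate two-edges, and this
  identifies the whole orbit (\<open>identified_diagonal\<close>). All inferences are
  available in both variants of the certification, so the same grid attains 60 for both numbers.
\<close>

section \<open>The upper bound\<close>

text \<open>Each column pair is contained in at most one row, and a set of \<open>k\<close> columns contains at least
  \<open>k - 1\<close> pairs.\<close>

lemma rectangle_free_card_le:
  assumes "rectangle_free m n A"
  shows "card {(i, j). (i, j) \<in> cells m n \<and> A i j} \<le> m + (n choose 2)"
proof -
  define R where "R i = {j \<in> {1..n}. A i j}" for i
  define Q where "Q i = {p. p \<subseteq> R i \<and> card p = 2}" for i
  have finR: "finite (R i)" for i by (simp add: R_def)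
  have finQ: "finite (Q i)" for i
    by (rule finite_subset[of _ "Pow (R i)"]) (auto simp: Q_def finR)
  have "{(i, j). (i, j) \<in> cells m n \<and> A i j} = Sigma {1..m} R"
    by (auto simp: cells_def R_def)
  then have "card {(i, j). (i, j) \<in> cells m n \<and> A i j} = (\<Sum>i = 1..m. card (R i))"
    by (simp add: card_SigmaI finR)
  also have "\<dots> \<le> (\<Sum>i = 1..m. 1 + card (Q i))"
  proof (rule sum_mono)
    fix i
    have "k \<le> 1 + (k choose 2)" for k :: nat
    proof (induction k)
      case (Suc k)
      then show ?case by (cases k) (auto simp: numeral_2_eq_2)
    qed simp
    moreover have "card (Q i) = card (R i) choose 2"
      unfolding Q_def by (rule n_subsets[OF finR])
    ultimately show "card (R i) \<le> 1 + card (Q i)" by simp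
  qed
  also have "\<dots> = m + (\<Sum>i = 1..m. card (Q i))"
    by (simp only: sum.distrib) simp
  also have "(\<Sum>i = 1..m. card (Q i)) = card (\<Union>i \<in> {1..m}. Q i)"
  proof (rule card_UN_disjoint[symmetric])
    show "\<forall>i \<in> {1..m}. \<forall>k \<in> {1..m}. i \<noteq> k \<longrightarrow> Q i \<inter> Q k = {}"
    proof (intro ballI impI equals0I)
      fix i k p
      assume ik: "i \<in> {1..m}" "k \<in> {1..m}" "i \<noteq> k" and "p \<in> Q i \<inter> Q k"
      then have "p \<subseteq> R i" "p \<subseteq> R k" "card p = 2" by (simp_all add: Q_def)
      then obtain j l where jl: "j \<noteq> l" "j \<in> R i" "l \<in> R i" "j \<in> R k" "l \<in> R k"
        by (metis card_2_iff insert_subset)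
      then have "j \<in> {1..n}" "l \<in> {1..n}" by (simp_all add: R_def)
      with ik jl assms show False
        unfolding rectangle_free_def R_def mem_Collect_eq by meson
    qed
  qed (use finQ in auto)
  also have "\<dots> \<le> card {p. p \<subseteq> {1..n} \<and> card p = 2}"
    by (rule card_mono) (auto simp: Q_def R_def intro: finite_subset[of _ "Pow {1..n}"])
  also have "\<dots> = n choose 2"
    using n_subsets[of "{1..n}" 2] by simp
  finally show ?thesis by simp
qed

text \<open>Distinct selected edges are disjoint, so they occupy \<open>card E1 + 2 * card E2\<close> different cells.\<close>

lemma simple_grid_card_le:
  assumes "simple_grid m n E1 E2"
  shows "card E1 + 2 * card E2 \<le> m * n"
proof -
  have E1: "E1 \<subseteq> cells m n" and E2: "E2 \<subseteq> cell_pairs m n"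
    and unique: "\<And>c e f. \<lbrakk>c \<in> cells m n; e \<in> selected_edges E1 E2; f \<in> selected_edges E1 E2;
      c \<in> e; c \<in> f\<rbrakk> \<Longrightarrow> e = f"
    using assms unfolding simple_grid_def is_grid_def by blast+
  have fin: "finite (cells m n)" and card_cells: "card (cells m n) = m * n"
    by (simp_all add: cells_def)
  have two: "card e = 2" "e \<subseteq> cells m n" if "e \<in> E2" for e
    using E2 that by (auto simp: cell_pairs_def)
  have finE1: "finite E1" using E1 fin by (rule finite_subset)
  have finE2: "finite E2"
    by (rule finite_subset[of _ "Pow (cells m n)"]) (use two fin in auto)
  have "E1 \<inter> \<Union> E2 = {}"
  proof (rule equals0I)
    fix c assume "c \<in> E1 \<inter> \<Union> E2"
    then obtain e where e: "c \<in> E1" "e \<in> E2" "c \<in> e" by blast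
    then have "{c} = e"
      by (intro unique[of c]) (use E1 in \<open>auto simp: selected_edges_def\<close>)
    then show False using two(1)[OF e(2)] by auto
  qed
  moreover have "finite (\<Union> E2)" using finE2 two(2) fin by (meson Sup_least finite_subset)
  ultimately have "card E1 + card (\<Union> E2) = card (E1 \<union> \<Union> E2)"
    by (simp add: card_Un_disjoint finE1)
  also have "\<dots> \<le> card (cells m n)"
    by (rule card_mono[OF fin]) (use E1 two(2) in blast)
  moreover have "card (\<Union> E2) = 2 * card E2"
  proof (rule card_partition[symmetric])
    fix e f assume "e \<in> E2" "f \<in> E2" "e \<noteq> f"
    then show "e \<inter> f = {}"
      using unique[of _ e f] two(2) by (fastforce simp: selected_edges_def)
  qed (use finE2 two fin in \<open>auto intro: finite_subset\<close>)
  ultimately show ?thesis by (simp add: card_cells)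
qed

section \<open>Grids given by an involution of the cells\<close>

text \<open>A path acts on an ordered pair of cells: \<open>S\<close> swaps the columns, which exchanges the two diagonals of
  a rectangle, and \<open>L\<close> and \<open>R\<close> replace the left or the right cell by the other cell of its two-edge.\<close>

datatype move = S | L | R

text \<open>The conditions on each move make it the inverse of a sound inference. The predicate \<open>glue\<close> selects
  the cells whose two-edges are already known to be identified. Moving a fixed point of \<open>mate\<close> is
  an idle step.\<close>

fun reaches_line :: "(cell \<Rightarrow> bool) \<Rightarrow> (cell \<Rightarrow> cell) \<Rightarrow> move list \<Rightarrow> cell \<Rightarrow> cell \<Rightarrow> bool" where
  "reaches_line glue mate [] a b \<longleftrightarrow> (fst a = fst b \<or> snd a = snd b) \<and> mate a \<noteq> b"
| "reaches_line glue mate (S # ms) a b \<longleftrightarrow>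
     fst a \<noteq> fst b \<and> snd a \<noteq> snd b \<and> mate a \<noteq> b \<and> mate (fst a, snd b) \<noteq> (fst b, snd a) \<and>
     reaches_line glue mate ms (fst a, snd b) (fst b, snd a)"
| "reaches_line glue mate (L # ms) a b \<longleftrightarrow>
     glue a \<and> mate a \<noteq> b \<and> reaches_line glue mate ms (mate a) b"
| "reaches_line glue mate (R # ms) a b \<longleftrightarrow>
     glue b \<and> mate b \<noteq> a \<and> reaches_line glue mate ms a (mate b)"

text \<open>A permutation of the rows together with a permutation of the columns preserves lines and rectangles.
  If it also commutes with \<open>mate\<close> and preserves \<open>glue\<close>, every test passed along the path is
  passed by the image pair as well.\<close>

lemma reaches_line_equivariant:
  assumes reach: "reaches_line glue mate ms a b" "a \<in> X \<times> Y" "b \<in> X \<times> Y"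
    and inj: "inj_on g X" "inj_on h Y"
    and mate_in: "\<And>a. a \<in> X \<times> Y \<Longrightarrow> mate a \<in> X \<times> Y"
    and mate: "\<And>a. a \<in> X \<times> Y \<Longrightarrow> mate (map_prod g h a) = map_prod g h (mate a)"
    and glue: "\<And>a. \<lbrakk>a \<in> X \<times> Y; glue a\<rbrakk> \<Longrightarrow> glue (map_prod g h a)"
  shows "reaches_line glue mate ms (map_prod g h a) (map_prod g h b)"
proof -
  have inj_gh: "map_prod g h a = map_prod g h b \<longleftrightarrow> a = b" if "a \<in> X \<times> Y" "b \<in> X \<times> Y" for a b
    using inj that by (auto simp: inj_on_def)
  from reach show ?thesis
  proof (induction ms arbitrary: a b)
    case Nil
    then show ?case by (auto simp: mate inj_gh mate_in)
  next
    case (Cons t ms)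
    obtain r c s d where ab: "a = (r, c)" "b = (s, d)" by fastforce
    have in1: "(r, d) \<in> X \<times> Y" "(s, c) \<in> X \<times> Y" "(r, c) \<in> X \<times> Y" "(s, d) \<in> X \<times> Y"
      using Cons.prems ab by auto
    note ma = mate[OF in1(1)] mate[OF in1(2)] mate[OF in1(3)] mate[OF in1(4)]
    note ga = inj_gh[OF mate_in[OF in1(1)] in1(2)] inj_gh[OF mate_in[OF in1(3)] in1(4)]
      inj_gh[OF mate_in[OF in1(4)] in1(3)]
    show ?case
    proof (cases t)
      case S
      have "g r \<noteq> g s" "h c \<noteq> h d"
        using Cons.prems inj in1 by (auto simp: S ab inj_on_def)
      then show ?thesis
        using Cons.prems Cons.IH[OF _ in1(1,2)] ma ga by (simp add: S ab)
    next
      case L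
      then show ?thesis
        using Cons.prems Cons.IH[OF _ mate_in[OF in1(3)] in1(4)] ma ga glue[OF in1(3)]
        by (simp add: ab)
    next
      case R
      then show ?thesis
        using Cons.prems Cons.IH[OF _ in1(3) mate_in[OF in1(4)]] ma ga glue[OF in1(4)]
        by (simp add: ab)
    qed
  qed
qed

locale cell_involution =
  fixes m n :: nat and mate :: "cell \<Rightarrow> cell"
  assumes mate_in: "a \<in> cells m n \<Longrightarrow> mate a \<in> cells m n"
    and mate_mate: "a \<in> cells m n \<Longrightarrow> mate (mate a) = a"
begin

definition ones :: "cell set" where
  "ones = {a \<in> cells m n. mate a = a}"

definition doubles :: "cell set set" where
  "doubles = {{a, mate a} |a. a \<in> cells m n \<and> mate a \<noteq> a}"

lemma pair_in_doubles_iff: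
  assumes "a \<in> cells m n" "a \<noteq> b"
  shows "{a, b} \<in> doubles \<longleftrightarrow> mate a = b"
proof
  assume "{a, b} \<in> doubles"
  then obtain c where "c \<in> cells m n" "{a, b} = {c, mate c}" by (auto simp: doubles_def)
  then show "mate a = b" using mate_mate[of c] by (metis doubleton_eq_iff)
next
  assume "mate a = b"
  then show "{a, b} \<in> doubles"
    unfolding doubles_def mem_Collect_eq by (intro exI[of _ a]) (use assms in simp)
qed

lemma selected_edges_iff:
  "e \<in> selected_edges ones doubles \<longleftrightarrow> (\<exists>a \<in> cells m n. e = {a, mate a})"
proof -
  have "(\<exists>a \<in> cells m n. e = {a, mate a}) \<longleftrightarrow>
      (\<exists>a \<in> cells m n. mate a = a \<and> e = {a}) \<or> (\<exists>a \<in> cells m n. mate a \<noteq> a \<and> e = {a, mate a})"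
    by (metis insert_absorb2)
  then show ?thesis
    unfolding selected_edges_def ones_def doubles_def by blast
qed

lemma selected_edge_through:
  assumes "e \<in> selected_edges ones doubles" "c \<in> e"
  shows "c \<in> cells m n" "e = {c, mate c}"
proof -
  obtain a where a: "a \<in> cells m n" "e = {a, mate a}"
    using assms(1) unfolding selected_edges_iff by blast
  then have "c = a \<or> c = mate a" using assms(2) by blast
  then show "c \<in> cells m n" "e = {c, mate c}"
    using a mate_in[of a] mate_mate[of a] by (metis insert_commute)+
qed

lemma is_simple_grid: "simple_grid m n ones doubles"
proof -
  have "ones \<subseteq> cells m n" by (auto simp: ones_def)
  moreover have "doubles \<subseteq> cell_pairs m n"
    using mate_in unfolding doubles_def cell_pairs_def by fastforce
  moreover have "e = f"
    if "e \<in> selected_edges ones doubles" "f \<in> selected_edges ones doubles" "c \<in> e" "c \<in> f" for c e f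
    using that selected_edge_through(2)[of e c] selected_edge_through(2)[of f c] by simp
  ultimately show ?thesis
    unfolding simple_grid_def is_grid_def by blast
qed

lemma card_ones_doubles: "card ones + 2 * card doubles = m * n"
proof -
  have fin: "finite (cells m n)" by (simp add: cells_def)
  have "doubles \<subseteq> Pow (cells m n)" using mate_in by (auto simp: doubles_def)
  then have fin2: "finite doubles" by (rule finite_subset) (simp add: fin)
  have Un: "\<Union> doubles = {a \<in> cells m n. mate a \<noteq> a}"
  proof (intro equalityI subsetI)
    fix x assume "x \<in> \<Union> doubles"
    then obtain a where "a \<in> cells m n" "mate a \<noteq> a" "x = a \<or> x = mate a"
      by (auto simp: doubles_def)
    then show "x \<in> {a \<in> cells m n. mate a \<noteq> a}"
      using mate_in[of a] mate_mate[of a] by auto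
  qed (auto simp: doubles_def)
  have "2 * card doubles = card (\<Union> doubles)"
  proof (rule card_partition)
    fix e f assume ef: "e \<in> doubles" "f \<in> doubles" "e \<noteq> f"
    then have "e \<in> selected_edges ones doubles" "f \<in> selected_edges ones doubles"
      by (simp_all add: selected_edges_def)
    then show "e \<inter> f = {}"
      using selected_edge_through(2) ef(3) by blast
  qed (simp add: fin2, simp add: Un fin, auto simp: doubles_def)
  moreover have "card ones + card {a \<in> cells m n. mate a \<noteq> a} = card (ones \<union> {a \<in> cells m n. mate a \<noteq> a})"
    by (rule card_Un_disjoint[symmetric]) (auto simp: ones_def fin)
  moreover have "ones \<union> {a \<in> cells m n. mate a \<noteq> a} = cells m n"
    by (auto simp: ones_def)
  ultimately show ?thesis using Un by (simp add: cells_def)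
qed

text \<open>Each rule that identifies a pair requires it to be a two-edge.\<close>

lemma identified_in_doubles: "identified signed m n ones doubles p \<Longrightarrow> p \<in> doubles"
  by (erule identified.cases) auto

text \<open>The rules are symmetric enough to be read backwards along the path: the line rule certifies its end,
  rectangle transfer undoes a swap, and saturation undoes a replacement. These
  rules belong to both variants, so the flag \<open>signed\<close> is arbitrary.\<close>

lemma certified_if_reaches_line:
  assumes glue: "\<And>a. \<lbrakk>a \<in> cells m n; glue a; mate a \<noteq> a\<rbrakk>
      \<Longrightarrow> identified signed m n ones doubles {a, mate a}"
    and "reaches_line glue mate ms a b" "a \<in> cells m n" "b \<in> cells m n" "a \<noteq> b"
  shows "certified signed m n ones doubles {a, b}"
  using assms(2-)
proof (induction ms arbitrary: a b)
  case Nil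
  then show ?case
    by (intro line_certified) (auto simp: pair_in_doubles_iff)
next
  have glued: "certified signed m n ones doubles {a, b}"
    if "certified signed m n ones doubles {mate a, b}" "glue a" "mate a \<noteq> b" "a \<noteq> b" "a \<in> cells m n"
    for a b
  proof (cases "mate a = a")
    case False
    then have "identified signed m n ones doubles {mate a, a}"
      using glue[of a] that by (simp add: insert_commute)
    then show ?thesis
      by (rule saturation) (use that in auto)
  qed (use that in simp)
  case (Cons t ms)
  show ?case
  proof (cases t)
    case S
    obtain r c s d where ab: "a = (r, c)" "b = (s, d)" by fastforce
    have rect: "r \<noteq> s" "c \<noteq> d" "mate (r, c) \<noteq> (s, d)" "mate (r, d) \<noteq> (s, c)"
      and "reaches_line glue mate ms (r, d) (s, c)"
      using Cons.prems by (auto simp: S ab)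
    moreover have in_cells: "(r, d) \<in> cells m n" "(s, c) \<in> cells m n"
      using Cons.prems by (auto simp: ab cells_def)
    ultimately have cert: "certified signed m n ones doubles {(r, d), (s, c)}"
      using Cons.IH[of "(r, d)" "(s, c)"] by simp
    have opp: "opposite_diagonals m n {(r, d), (s, c)} {(r, c), (s, d)}"
      unfolding opposite_diagonals_def
      by (rule bexI[of _ r], rule bexI[of _ s], rule bexI[of _ d], rule bexI[of _ c])
        (use rect Cons.prems in \<open>auto simp: ab cells_def\<close>)
    show ?thesis
      unfolding ab by (rule transfer_none[OF opp _ _ cert])
        (use rect Cons.prems in_cells in \<open>simp_all add: pair_in_doubles_iff ab\<close>)
  next
    case L
    then have step: "glue a" "mate a \<noteq> b" "reaches_line glue mate ms (mate a) b"
      using Cons.prems by simp_all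
    have "certified signed m n ones doubles {mate a, b}"
      by (rule Cons.IH[OF step(3)]) (use Cons.prems mate_in[of a] step(2) in simp_all)
    then show ?thesis
      by (rule glued) (use Cons.prems step in simp_all)
  next
    case R
    then have step: "glue b" "mate b \<noteq> a" "reaches_line glue mate ms a (mate b)"
      using Cons.prems by simp_all
    have "certified signed m n ones doubles {a, mate b}"
      by (rule Cons.IH[OF step(3)]) (use Cons.prems mate_in[of b] step(2) in auto)
    then have "certified signed m n ones doubles {mate b, a}" by (simp add: insert_commute)
    then have "certified signed m n ones doubles {b, a}"
      by (rule glued) (use Cons.prems step in simp_all)
    then show ?thesis by (simp add: insert_commute)
  qed
qed

text \<open>Certified pairs are unordered, so a path for either order of the cells will do; pairs on a line need
  none.\<close>

lemma satisfies_RW3_if: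
  assumes ident: "\<And>a. \<lbrakk>a \<in> cells m n; mate a \<noteq> a\<rbrakk> \<Longrightarrow> identified signed m n ones doubles {a, mate a}"
    and paths: "\<And>a b. \<lbrakk>a \<in> cells m n; b \<in> cells m n; fst a \<noteq> fst b; snd a \<noteq> snd b; mate a \<noteq> b\<rbrakk>
      \<Longrightarrow> \<exists>ms. reaches_line (\<lambda>_. True) mate ms a b \<or> reaches_line (\<lambda>_. True) mate ms b a"
  shows "satisfies_RW3 signed m n ones doubles"
proof -
  have cert: "certified signed m n ones doubles {a, b}"
    if ab: "a \<in> cells m n" "b \<in> cells m n" "a \<noteq> b" "mate a \<noteq> b" for a b
  proof -
    have "\<exists>ms. reaches_line (\<lambda>_. True) mate ms a b \<or> reaches_line (\<lambda>_. True) mate ms b a"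
    proof (cases "fst a = fst b \<or> snd a = snd b")
      case True
      then show ?thesis using ab by (intro exI[of _ "[]"] disjI1) simp
    qed (use paths[OF ab(1,2)] ab(4) in simp)
    then obtain ms where
      "reaches_line (\<lambda>_. True) mate ms a b \<or> reaches_line (\<lambda>_. True) mate ms b a" ..
    then show ?thesis
    proof
      assume "reaches_line (\<lambda>_. True) mate ms a b"
      from certified_if_reaches_line[OF ident this ab(1-3)] show ?thesis by simp
    next
      assume "reaches_line (\<lambda>_. True) mate ms b a"
      from certified_if_reaches_line[OF ident this ab(2,1) ab(3)[symmetric]]
      show ?thesis by (simp add: insert_commute)
    qed
  qed
  have "certified signed m n ones doubles {a, b}"
    if "e \<in> selected_edges ones doubles" "f \<in> selected_edges ones doubles" "e \<noteq> f" "a \<in> e" "b \<in> f"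
    for e f a b
  proof (rule cert)
    note ea = selected_edge_through[OF that(1,4)] and fb = selected_edge_through[OF that(2,5)]
    show "a \<in> cells m n" "b \<in> cells m n" using ea(1) fb(1) .
    show "a \<noteq> b" using ea fb that(3) by auto
    show "mate a \<noteq> b" using ea fb that(3) mate_mate[OF ea(1)] by auto
  qed
  moreover have "identified signed m n ones doubles p \<longleftrightarrow> p \<in> doubles" for p
  proof
    assume "p \<in> doubles"
    then obtain a where "a \<in> cells m n" "mate a \<noteq> a" "p = {a, mate a}"
      unfolding doubles_def by blast
    then show "identified signed m n ones doubles p" using ident by simp
  qed (rule identified_in_doubles)
  ultimately show ?thesis
    unfolding satisfies_RW3_def by (intro conjI ballI impI) (simp_all add: set_eq_iff)
qed

end

section \<open>A grid with five-fold rotational symmetry\<close>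

text \<open>The table of \<open>partner\<close> below is used as rewrite rules whose left-hand sides contain the numeral 1;
  the simplifier must not turn it into \<open>Suc 0\<close>.\<close>

declare One_nat_def [simp del]

text \<open>Columns \<open>1, \<dots>, 5\<close> are the vertices \<open>0, \<dots>, 4\<close>, taken modulo 5, and column 6 is the vertex \<open>\<infinity>\<close>. Row
  \<open>5 * t + i + 1\<close> is the edge \<open>{i, \<infinity>}\<close> for \<open>t = 0\<close>, \<open>{i - 1, i + 1}\<close> for \<open>t = 1\<close> and \<open>{i - 2, i + 2}\<close> for
  \<open>t = 2\<close>. The column is given relative to \<open>i\<close>, as the vertex \<open>i + d\<close>, with \<open>d = 5\<close> standing for \<open>\<infinity>\<close>.
  The incidences are then the cells with \<open>(t, d)\<close> among \<open>(0, 0), (0, 5), (1, 1), (1, 4), (2, 2), (2, 3)\<close>;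
  the other twelve values of \<open>(t, d)\<close> are matched by \<open>two_edges\<close>.\<close>

definition cell_at :: "nat \<Rightarrow> nat \<Rightarrow> nat \<Rightarrow> cell" where
  "cell_at t i d = (5 * t + i mod 5 + 1, if d = 5 then 6 else (i + d) mod 5 + 1)"

definition two_edges :: "(cell \<times> cell) list" where
  "two_edges = concat (map (\<lambda>i.
     [(cell_at 0 i 1, cell_at 0 i 2), (cell_at 0 i 3, cell_at 2 (i + 3) 5),
      (cell_at 0 i 4, cell_at 1 (i + 2) 2), (cell_at 1 i 5, cell_at 1 i 3),
      (cell_at 1 i 0, cell_at 2 i 0), (cell_at 2 i 1, cell_at 2 i 4)]) [0..<5])"

definition partner :: "cell \<Rightarrow> cell" where
  "partner a = (case map_of (two_edges @ map prod.swap two_edges) a of None \<Rightarrow> a | Some b \<Rightarrow> b)"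

definition cell_list :: "cell list" where
  "cell_list = List.product [1..<16] [1..<7]"

lemma set_cell_list: "set cell_list = cells 15 6"
  by (auto simp: cell_list_def cells_def)

text \<open>The defining equation is first instantiated to all 90 cells. Simplifying it for a variable cell would
  lead to a huge nest of case distinctions.\<close>

lemma partner_table_raw: "list_all (\<lambda>a. partner a =
   (case map_of (two_edges @ map prod.swap two_edges) a of None \<Rightarrow> a | Some b \<Rightarrow> b)) cell_list"
  by (simp add: partner_def list_all_iff)

lemmas upt_eval = upt_rec[of 0 "numeral v" for v] upt_rec[of 1 "numeral v" for v] One_nat_def[symmetric]

lemmas two_edges_eval =
  two_edges_def[unfolded cell_at_def, simplified upt_eval, simplified]
lemmas cell_list_eval = cell_list_def[simplified upt_eval, simplified]

lemmas partner_table =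
  partner_table_raw[unfolded cell_list_eval list.pred_inject, simplified two_edges_eval, simplified]

text \<open>The rotation adds 1 to \<open>i\<close>, within a block of five rows and among the first five columns.\<close>

definition rot_row :: "nat \<Rightarrow> nat" where
  "rot_row r = (if 5 dvd r then r - 4 else r + 1)"

definition rot_col :: "nat \<Rightarrow> nat" where
  "rot_col c = (if c = 6 then 6 else if c = 5 then 1 else c + 1)"

abbreviation rot :: "cell \<Rightarrow> cell" where
  "rot \<equiv> map_prod rot_row rot_col"

lemma ball_cells_iff: "(\<forall>a \<in> cells 15 6. P a) \<longleftrightarrow> list_all P cell_list"
  by (simp add: list_all_iff flip: set_cell_list)

lemma partner_in: "a \<in> cells 15 6 \<Longrightarrow> partner a \<in> cells 15 6"
proof -
  have "\<forall>a \<in> cells 15 6. partner a \<in> cells 15 6"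
    unfolding ball_cells_iff cell_list_eval list.pred_inject by (simp add: partner_table cells_def)
  then show "a \<in> cells 15 6 \<Longrightarrow> partner a \<in> cells 15 6" by blast
qed

lemma partner_partner: "a \<in> cells 15 6 \<Longrightarrow> partner (partner a) = a"
proof -
  have "\<forall>a \<in> cells 15 6. partner (partner a) = a"
    unfolding ball_cells_iff cell_list_eval list.pred_inject by (simp add: partner_table)
  then show "a \<in> cells 15 6 \<Longrightarrow> partner (partner a) = a" by blast
qed

lemma rot_in: "a \<in> cells 15 6 \<Longrightarrow> rot a \<in> cells 15 6"
proof -
  have "\<forall>a \<in> cells 15 6. rot a \<in> cells 15 6"
    unfolding ball_cells_iff cell_list_eval list.pred_inject
    by (simp add: rot_row_def rot_col_def cells_def)
  then show "a \<in> cells 15 6 \<Longrightarrow> rot a \<in> cells 15 6" by blast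
qed

lemma partner_rot: "a \<in> cells 15 6 \<Longrightarrow> partner (rot a) = rot (partner a)"
proof -
  have "\<forall>a \<in> cells 15 6. partner (rot a) = rot (partner a)"
    unfolding ball_cells_iff cell_list_eval list.pred_inject
    by (simp add: rot_row_def rot_col_def partner_table flip: One_nat_def)
  then show "a \<in> cells 15 6 \<Longrightarrow> partner (rot a) = rot (partner a)" by blast
qed

lemma inj_rot_row: "inj_on rot_row {1..15}"
  by (auto simp: inj_on_def rot_row_def split: if_splits; presburger)

lemma inj_rot_col: "inj_on rot_col {1..6}"
  by (auto simp: inj_on_def rot_col_def split: if_splits)

section \<open>One-edges and the Zarankiewicz number\<close>

interpretation grid: cell_involution 15 6 partner
  by unfold_locales (fact partner_in, fact partner_partner)

lemma card_ones: "card grid.ones = 30"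
proof -
  have "grid.ones = set (filter (\<lambda>a. partner a = a) cell_list)"
    by (auto simp: grid.ones_def set_cell_list)
  moreover have "distinct (filter (\<lambda>a. partner a = a) cell_list)"
    by (simp add: cell_list_def distinct_product)
  moreover have "length (filter (\<lambda>a. partner a = a) cell_list) = 30"
    by (simp add: cell_list_eval partner_table)
  ultimately show ?thesis by (metis distinct_card)
qed

lemma rectangle_free_ones: "rectangle_free 15 6 (\<lambda>i j. (i, j) \<in> grid.ones)"
proof -
  \<comment> \<open>Two different edges of the complete graph have at most one vertex in common.\<close>
  have *: "list_all (\<lambda>i. list_all (\<lambda>k. i = k \<or>
      length (filter (\<lambda>j. partner (i, j) = (i, j) \<and> partner (k, j) = (k, j)) [1..<7]) \<le> 1)
      [1..<16]) [1..<16]"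
    by (simp add: upt_eval partner_table)
  have no_rectangle: False
    if "i \<in> {1..15}" "k \<in> {1..15}" "j \<in> {1..6}" "l \<in> {1..6}"
      "(i, j) \<in> grid.ones" "(i, l) \<in> grid.ones" "(k, j) \<in> grid.ones" "(k, l) \<in> grid.ones"
      and neq: "i \<noteq> k" "j \<noteq> l" for i k j l
  proof -
    define js where "js = filter (\<lambda>j. partner (i, j) = (i, j) \<and> partner (k, j) = (k, j)) [1..<7]"
    have "length js \<le> 1"
    proof -
      have "i \<in> set [1..<16]" "k \<in> set [1..<16]" using that(1,2) by auto
      with * neq show ?thesis unfolding list_all_iff js_def by blast
    qed
    moreover have "{j, l} \<subseteq> set js"
      using that by (auto simp: js_def grid.ones_def)
    then have "card {j, l} \<le> length js"
      by (meson List.finite_set card_length card_mono order_trans)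
    ultimately show False using neq by simp
  qed
  show ?thesis
    unfolding rectangle_free_def by (intro notI) (elim bexE conjE, rule no_rectangle)
qed

lemma zarankiewicz_15_6: "zarankiewicz 15 6 = 30"
  unfolding zarankiewicz_def
proof (rule Max_eqI[OF finite_nonempty_zarankiewicz(1)])
  fix y assume "y \<in> {card {(i, j). (i, j) \<in> cells 15 6 \<and> A i j} |A. rectangle_free 15 6 A}"
  then obtain A where "rectangle_free 15 6 A" "y = card {(i, j). (i, j) \<in> cells 15 6 \<and> A i j}"
    by blast
  then have "y \<le> 15 + (6 choose 2)" using rectangle_free_card_le by blast
  then show "y \<le> 30" by (simp add: choose_two)
next
  have "{(i, j). (i, j) \<in> cells 15 6 \<and> (i, j) \<in> grid.ones} = grid.ones"
    by (auto simp: grid.ones_def)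
  then have "30 = card {(i, j). (i, j) \<in> cells 15 6 \<and> (i, j) \<in> grid.ones}"
    by (simp only: card_ones)
  then show "30 \<in> {card {(i, j). (i, j) \<in> cells 15 6 \<and> A i j} |A. rectangle_free 15 6 A}"
    using rectangle_free_ones by (intro CollectI exI[of _ "\<lambda>i j. (i, j) \<in> grid.ones"] conjI)
qed

section \<open>Paths to a line\<close>

text \<open>
  An entry \<open>((r, s), paths)\<close> holds one path for each pair of cells with a cell in row \<open>r\<close>, a cell in
  row \<open>s\<close> and different columns, in the order in which \<open>skew_columns r s\<close> lists the two columns; a pair
  that is itself a two-edge has no path.

  The row pairs are representatives for the rotation: two rows of the first kind of edge, say, are
  carried to \<open>{1, 2}\<close> or to \<open>{1, 3}\<close>, while for two rows of different kinds the first one can be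
  moved to the beginning of its block of five, after which the second one is arbitrary.
\<close>

definition line_paths :: "((nat \<times> nat) \<times> move list list) list" where
  "line_paths = [
    ((1, 2), [
      [S,L,S,R,S,R,S,R,S,L], [R,S,R,S,R,S,L], [S,R,S,R,S,L], [S,L,S,R,L],
      [S,R,S,R,S,R,L,S,R,S,R,S,R,S,L], [L,S,R,S,R,S,R,S,L], [L], [R,L], [L,S,R,S,R,L],
      [L,S,R,S,L], [S,R,S,R,S,R,S,L], [L], [R], [S,R,S,R,L], [S,R,S,L], [R,S,R,S,L], [S,R,L], [R],
      [R,L], [L], [L,S,R,L], [S,L,S,R,S,R,L], [R,S,R,L], [S,R,L], [S,R],
      [R,S,R,S,R,L,S,R,S,R,S,R,S,L], [S,L,S,R,S,L], [R,S,L], [S,L], [R]]),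
    ((1, 3), [
      [S,R,S,R,S,R,S,R,S,R,L], [S,R,L,S,R,S,R,S,R,S,R,L], [S,R,L], [R,S,R,L], [S,R],
      [R,S,R,S,R,S,R,S,R,L], [L], [S,R,S,L,S,R,L], [R,S,R,S,L,S,R,L], [S,R,S,R,L],
      [R,L,S,R,S,R,S,R,S,R,L], [L], [S,L,S,L,S,R,L], [R,S,L,S,L,S,R,L], [L,S,R,S,R,L], [R,L],
      [R,S,L,S,R,L], [L,S,L,S,R,L], [R], [L], [S,R,S,R,L], [R,S,L,S,R,S,R,S,R],
      [S,R,S,L,S,L,S,R,L], [R], [S,R,S,L], [R], [R,S,R,L], [S,L,S,R,S,R,L], [S,L], [R,S,L]]),
    ((1, 6), [
      [S,L,S,R,S,L,S,R,S,R,S,R,L], [R,S,L,S,R,S,R,S,R,L], [R,S,R,S,R],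
      [S,R,L,S,L,S,R,L,S,R,S,R,L], [S,R,S,R], [L,S,R,S,L,S,R,S,R,S,R,L], [L], [R,L,S,R,S,L,S,R],
      [L,S,R,L,S,R,S,L,S,L,S,L], [L,S,R,S,L,S,R], [S,R,S,L,S,R,S,R,S,R,L], [L], [R,S,R,S,L,S,R],
      [S,R,L,S,R,S,L,S,L,S,L], [S,R,S,L,S,R], [R,L,S,R], [L,S,R,S,L,S,R,L], [R,S,L,S,R,L],
      [L,S,L,S,R,L,S,L,S,R,L], [R], [R,L,S,L,S,R,L,S,R,S,R,L], [S,L,S,R,L,S,R,S,L,S,L,S,L],
      [R,L,S,R,S,L,S,L,S,L], [S,L,S,L,S,R,L,S,L,S,R,L], [R,S,L,S,L,S,R,L,S,L,S,R,L], [R,S,R],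
      [S,L,S,R,S,L,S,R], [R,S,L,S,R], [R], [S,R,S,L,S,L,S,R,L,S,L,S,R,L]]),
    ((1, 7), [
      [R,S,R,L], [S,L,S,R,S,R,L], [R,S,R,S,L,S,R,L], [S,L,S,R,L], [R,S,L,S,R,L], [S,R,S,R,L], [L],
      [S,R,L,S,R], [R,S,R,S,R], [S,R,S,R], [L,S,R,S,R,L], [L], [R,S,R,L], [R,L,S,R,S,R],
      [L,S,R,S,R], [S,R,S,R,S,L,S,R,L], [R,L,S,R], [L,S,R,L], [R,L], [L], [L,S,R,L],
      [S,R,S,R,S,R], [L,S,R,L,S,L], [S,R,L], [R], [S,R,S,L,S,R,L], [R,S,R], [S,L,S,R,S,R], [S,L],
      [R]]),
    ((1, 8), [
      [S,R,L,S,R,S,R], [S,R,S,R,S,R], [S,R,L], [R], [R], [R,L,S,R,S,R], [L], [L,S,R,S,R,L], [R],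
      [L,S,R,S,R], [R,S,R,S,R], [L], [S,R,S,R,L], [R], [S,R,S,R], [R,L], [S,L,S,R,S,R,L],
      [R,S,R,L], [R], [L], [L], [L], [L], [L], [L], [R], [S,L,S,R,S,R], [R,S,R], [S,L], [R]]),
    ((1, 9), [
      [S,R,L,S,R,S,R,S,R,S,L], [S,R,S,R,S,R,S,R,S,L], [R,S,L], [S,R,L,S,R,L],
      [R,S,R,L,S,R,S,R,S,R,S,L], [R,L,S,R,S,R,S,R,S,L], [L], [S,R,L], [S,R,L,S,L,S,R,S,R,L], [R],
      [R,S,R,S,R,S,R,S,L], [L], [R,S,L], [L,S,R,L,S,L,S,R,S,R,L], [R,L], [S,R,S,L], [R,L],
      [S,R,S,L], [S,R,S,L], [L], [R,L,S,R,L], [R,L,S,L,S,R,S,R,L], [S,L,S,R,L,S,L,S,R,S,R,L],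
      [R,S,L], [L,S,L,S,R,S,R,L], [S,R,S,R,L,S,R,S,R,S,R,S,L], [R], [S,R,L], [S,L],
      [S,L,S,L,S,R,S,R,L]]),
    ((1, 10), [
      [R,S,R,S,R,S,R,S,R,S,R,L], [S,L,S,R,S,R,S,R,S,R,S,R,S,R,L],
      [S,L,S,R,S,L,S,R,S,R,S,R,S,L,S,R,S,L], [R,S,L,S,L,S,R], [R,S,L,S,R,S,R,S,R,S,R,S,R,S,R,L],
      [S,R,S,R,S,R,S,R,S,R,S,R,L], [L], [L,S,R,L], [L,S,R,S,R,S,R], [R,L],
      [L,S,R,S,R,S,R,S,R,S,R,S,R,L], [L], [S,R,L], [S,R,S,R,S,R], [R],
      [L,S,R,S,L,S,R,S,R,S,R,S,L,S,R,S,L], [S,L,S,R,L], [R,L], [L,S,R,L], [L], [L,S,R,L,S,R],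
      [S,L,S,R,S,R,S,R], [R,S,R,S,R], [S,L,S,R,L], [S,R,S,R], [S,R,S,L,S,R,S,R,S,R,S,R,S,R,S,R,L],
      [S,R,L], [R], [S,L], [R,S,R]]),
    ((1, 11), [
      [R,S,L,S,L,S,R,L,S,R,S,R,L], [S,R,S,R,S,L,S,R,S,R,S,R,L], [S,L,S,R],
      [S,L,S,L,S,R,L,S,R,S,R,L], [R], [R,L,S,R,S,L,S,R,S,R,S,R,L], [L], [S,R,L,S,R,S,R,S,R,S,L],
      [R], [S,R,S,R,S,R,S,R,L], [R,S,R,S,L,S,R,S,R,S,R,L], [L], [S,L,S,R,L,S,R,S,R,S,L], [R,L],
      [L,S,R,S,R,S,R,S,R,L], [L,S,R], [R,L,S,R,S,R,S,R,S,L], [L,S,R,L,S,R,S,R,S,L],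
      [L,S,R,S,R,S,R,S,L], [L], [L,S,L,S,R,L,S,R,S,R,L], [R], [S,R,L], [S,L,S,R,S,R,S,R,S,L],
      [R,S,R,S,R,L], [S,R], [R,S,R,S,R,S,R,L], [S,L,S,R,S,R,S,R,S,R,L], [S,L], [S,R,S,R,S,R,L]]),
    ((1, 12), [
      [S,R,L], [R], [S,R,S,L,S,L,S,R], [S,L,S,L,S,R,S,R,S,R,L], [S,R,S,R,L], [R,L], [L],
      [S,L,S,R], [S,R,S,R,S,R,S,R], [R], [R], [L], [L,S,L,S,R], [L,S,R,S,R,S,R,S,R], [R,L],
      [R,S,L,S,L,S,R], [L,S,R], [S,L,S,L,S,R], [L,S,L,S,L,S,L,S,L,S,R], [L],
      [L,S,L,S,R,S,R,S,R,L], [R,S,R,S,R,S,R], [S,L,S,R,S,R,S,R,S,R], [S,L,S,L,S,L,S,L,S,L,S,R],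
      [R,L,S,R,S,R,L], [R,S,R,L], [S,R], [S,R,L], [S,L], [S,R,L,S,R,S,R,L]]),
    ((1, 13), [
      [S,L,S,R,S,R,S,R,S,R], [R,S,R,S,R,S,R], [R,S,L,S,R,S,R,S,R,S,R], [S,L,S,L,S,R,S,L,S,R],
      [R,S,R,L], [L,S,R,S,R,S,R,S,R], [L], [R], [L,S,R,L], [R,L], [S,R,S,R,S,R,S,R], [L], [R,L],
      [S,R,L], [R], [L,S,R,S,R,S,R,S,R,L], [R], [S,R,L], [L,S,R,L], [L], [L,S,L,S,R,S,L,S,R],
      [S,L,S,R,L], [R,L], [S,L,S,R,L], [R,L,S,L,S,R], [S,R,S,R,L], [S,R,L], [S,R], [S,L],
      [S,R,L,S,L,S,R]]),
    ((1, 14), [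
      [S,L,S,R,S,L,S,L,S,R,L], [R,S,L,S,L,S,R,L], [S,L], [S,L,S,L,S,R,L], [R],
      [L,S,R,S,L,S,L,S,R,L], [L], [S,L], [R,L], [R], [S,R,S,L,S,L,S,R,L], [L], [S,L], [R], [R],
      [L], [L], [L], [L], [L,S,L,S,R,L], [S,R,L], [R], [S,L], [R], [S,R], [S,R], [S,R], [R,S,L],
      [S,R]]),
    ((1, 15), [
      [S,R,L,S,L,S,R,L], [S,R,S,L,S,R,L], [R], [S,L,S,L,S,R], [S,R,S,L], [R,L,S,L,S,R,L], [L],
      [L,S,L,S,R,L], [R,L,S,R,S,R,S,R], [R,L,S,R,S,R,L], [R,S,L,S,R,L], [L], [S,L,S,R,L],
      [R,S,R,S,R,S,R], [R,S,R,S,R,L], [R], [S,L,S,L,S,R,L], [L,S,R,L], [L,S,R], [L], [L,S,L,S,R],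
      [S,R,L,S,R,S,R,S,R], [S,R,S,R,S,R,S,R], [S,L,S,R], [R], [R,S,L], [S,R,L,S,R,S,R,L],
      [S,R,S,R,S,R,L], [S,L], [S,R]]),
    ((6, 7), [
      [L,S,L,S,R,S,L], [S,L,S,L,S,R,L,S,L,S,R,S,R,L], [S,L,S,L,S,L], [R,L,S,L], [L,S,L],
      [S,L,S,L,S,R,S,L], [S,R,L,S,L], [S,R,L,S,R], [R,S,R,S,R], [S,R,S,R],
      [L,S,L,S,R,L,S,L,S,R,S,R,L], [R,L,S,L], [R,S,R,L], [R,S,L,S,R,S,R,L], [S,L,S,R,S,R,L],
      [L,S,L,S,L], [R,L,S,R], [S,R,S,R,L], [R,L], [L], [S,R,L,S,L], [S,R,S,R,S,R],
      [S,R,S,L,S,R,S,R,L], [S,R,L], [R], [S,L,S,L], [R,S,R], [L,S,R,S,R,L], [L], [R]]),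
    ((6, 8), [
      [L,S,R,L,S,R,L,S,L,S,R,L], [S,R,S,R,S,R], [S,R,L], [L,S,R,S,R,L,S,L,S,R,L], [R],
      [S,L,S,R,L,S,R,L,S,L,S,R,L], [R,S,R,S,L,S,R], [S,L,S,R,S,L,S,R,L,S,R,L,S,L,S,R,L],
      [R,S,R,S,R,L,S,L,S,R,S,R,S,R], [R,S,L,S,R,L,S,R,L,S,L,S,R,L], [R,S,R,S,R], [L,S,L,S,R,L],
      [S,R,L,S,R], [L,S,L,S,R,S,R,S,R], [S,R,S,R], [R,L], [L,S,R,S,L,S,R,L,S,R,L,S,L,S,R,L],
      [R,L,S,R], [R,S,R,S,R,S,R,L,S,R,S,R,L], [L], [S,L,S,R,S,R,L,S,L,S,R,L],
      [S,R,S,R,S,R,L,S,L,S,R,S,R,S,R], [S,L,S,L,S,R,S,R,S,R], [S,R,S,R,S,R,S,R,L,S,R,S,R,L],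
      [R,S,L,S,R,S,R,L,S,L,S,R,L], [R], [S,R,S,L,S,R,L,S,R,L,S,L,S,R,L], [R,S,R], [L],
      [S,R,S,L,S,R,S,R,L,S,L,S,R,L]]),
    ((6, 11), [
      [L], [L], [L], [L], [R], [R], [S,L,S,L,S,R,L], [S,L,S,R,S,L,S,R], [R], [R,S,L,S,R], [R],
      [L,S,L,S,R,L], [S,L,S,R,S,L,S,R], [L,S,L,S,R,L], [R,S,L,S,R], [R], [L,S,R,S,L,S,R],
      [L,S,R,S,L,S,R], [L,S,R,S,L,S,R], [L], [R], [R], [S,L,S,L,S,R,L], [S,L,S,R,S,L,S,R],
      [R,S,L,S,R], [R], [S,R,S,L,S,R], [S,R,S,L,S,R], [L], [S,R,S,L,S,R]]),
    ((6, 12), [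
      [S,R,S,L,S,L], [R], [S,L,S,L,S,L], [S,R,S,L,S,R,L], [L,S,L], [R,S,L,S,L], [S,L,S,L],
      [S,L,S,R], [S,R,S,R,S,R,S,R], [R], [R], [L,S,L], [S,L,S,R,L], [L,S,R,L], [R,L], [L,S,L,S,L],
      [L,S,R], [L,S,R,L], [L,S,R,S,R,S,R,L,S,L], [L], [R,S,L,S,R,L], [R,S,R,S,R,S,R], [S,L,S,R,L],
      [S,L,S,R,S,R,S,R,L,S,L], [R,S,R,S,R,L,S,L], [S,L,S,L], [S,R], [S,R,L], [L],
      [S,R,S,R,S,R,L,S,L]]),
    ((6, 13), [
      [R,S,L,S,L,S,L], [R,S,R,S,R,S,R], [S,L,S,L,S,L], [L,S,L,S,R,L,S,L,S,L,S,L], [L,S,L],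
      [S,R,S,L,S,L,S,L], [S,R,S,L,S,R], [R], [S,R,S,L,S,R,S,L,S,L,S,R,S,R,L], [S,R,L],
      [S,R,S,R,S,R,S,R], [R,S,L,S,R], [S,L,S,R], [L,S,R,L,S,R,S,R,S,R], [R], [L,S,L,S,L], [R],
      [L,S,R], [L,S,R,S,L,S,L,S,R,S,R,L], [L], [S,L,S,L,S,R,L,S,L,S,L,S,L],
      [R,S,L,S,R,S,L,S,L,S,R,S,R,L], [R,S,L,S,L,S,R,S,R,S,R], [S,L,S,R,S,L,S,L,S,R,S,R,L],
      [R,S,L,S,L,S,R,S,R,L], [S,L,S,L], [R,L], [S,R], [L], [S,R,S,L,S,L,S,R,S,R,L]]),
    ((6, 14), [
      [L,S,L,S,R,L,S,L,S,R,L], [S,L,S,R,L], [S,L,S,L,S,L], [R,S,L,S,R,L], [L,S,L],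
      [S,L,S,L,S,R,L,S,L,S,R,L], [S,L,S,L,S,R,S,R,S,R,S,L], [R,S,R,L],
      [R,S,L,S,L,S,R,S,R,S,R,S,L], [S,L,S,R,S,R,L], [L,S,R,L], [L,S,L,S,R,S,R,S,R,S,L],
      [S,L,S,R,L,S,R,S,R,L], [R], [R,L,S,R,S,R,L], [L,S,L,S,L], [S,R,S,R,L], [L,S,R,L,S,R,S,R,L],
      [R,L,S,R,L,S,R,S,R,L], [R], [S,R,S,L,S,R,L], [S,R,S,L,S,L,S,R,S,R,S,R,S,L], [R],
      [S,R,L,S,R,L,S,R,S,R,L], [S,R,S,R,L,S,R,S,R,L], [S,L,S,L], [L,S,R,S,R,L], [S,R,L,S,R,S,R,L],
      [L], [R,S,R,L,S,R,S,R,L]]),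
    ((6, 15), [
      [L,S,L,S,L,S,R,S,L,S,R], [S,R,S,L,S,R,S,R,S,R,L], [R], [S,R,S,L,S,R], [L,S,L],
      [S,L,S,L,S,L,S,R,S,L,S,R], [S,L,S,L,S,L,S,L,S,L,S,L,S,R], [R,S,L,S,L,S,L,S,R,S,L,S,R],
      [R,S,R,S,R,S,R,L,S,R,S,L,S,R,L], [S,L,S,R,S,L,S,L,S,L,S,R,S,L,S,R], [R,S,L,S,R,S,R,S,R,L],
      [L,S,L,S,L,S,L,S,L,S,L,S,R], [S,L,S,R,S,R,S,R,L], [R,S,R,S,R,S,R], [R,S,R,S,R,L], [R],
      [S,R,S,L,S,L,S,L,S,R,S,L,S,R], [L,S,R,S,R,S,R,L], [L,S,R], [L], [R,S,L,S,R],
      [S,R,S,R,S,R,S,R,L,S,R,S,L,S,R,L], [S,R,S,R,S,R,S,R], [S,L,S,R], [R], [R,L],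
      [L,S,R,S,L,S,L,S,L,S,R,S,L,S,R], [S,R,S,R,S,R,L], [L], [S,R]]),
    ((11, 12), [
      [R,S,L,S,R,S,L], [R], [L,S,L,S,L,S,L], [L,S,R,S,L,S,R,L], [S,L], [S,R,S,L,S,R,S,L],
      [R,S,R,S,L,S,R,S,L], [S,R,S,L,S,R,S,L,S,L,S,R,L], [L], [R], [R], [S,R,S,R,S,L,S,R,S,L],
      [S,R,S,L,S,L,S,L,S,L], [S,R,L,S,R,S,L,S,R,S,L], [S,R,L], [S,L,S,L,S,L,S,L],
      [R,S,L,S,R,S,L,S,L,S,R,L], [R,S,L,S,L,S,L,S,L], [S,L,S,R,S,L,S,R,S,L,S,L,S,R,L],
      [S,L,S,L,S,L,S,R,L], [L,S,R,S,L,S,R,S,L], [L], [R,L,S,R,S,L,S,R,S,L],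
      [L,S,R,S,L,S,R,S,L,S,L,S,R,L], [R,L], [L], [S,R], [R,L], [L,S,L,S,L,S,R,L], [S,R,L]]),
    ((11, 13), [
      [R,L,S,L,S,L,S,L], [R,S,R,S,R,S,R], [L,S,L,S,L,S,L], [S,L,S,R,L,S,L,S,L,S,L], [S,L],
      [S,R,L,S,L,S,L,S,L], [R,L,S,R,S,R,L], [R], [L], [R,S,R,S,R,S,L], [S,R,S,R,S,R,S,R],
      [S,R,L,S,R,S,R,L], [R,S,R,L,S,R,S,R,L], [S,R,S,R,S,R,L], [R], [S,L,S,L,S,L,S,L], [R],
      [S,R,S,R,L,S,R,S,R,L], [S,R,L], [S,R,S,R,S,R,S,R,S,L], [L,S,R,L,S,L,S,L,S,L], [L],
      [R,S,R,S,R,L], [R,L], [R,L,S,R,S,R,S,L], [L], [S,R,S,R,S,R,S,L], [S,R], [R,S,R,S,R,S,R,S,L],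
      [S,R,L,S,R,S,R,S,L]])]"

definition skew_columns :: "nat \<Rightarrow> nat \<Rightarrow> (nat \<times> nat) list" where
  "skew_columns r s =
     filter (\<lambda>(c, d). c \<noteq> d \<and> partner (r, c) \<noteq> (s, d)) (List.product [1..<7] [1..<7])"

text \<open>Once the filter is split, the rows occur only in the outer condition, so that the inner list can
  be evaluated for all rows at once.\<close>

lemma skew_columns_split:
  "skew_columns r s = filter (\<lambda>(c, d). partner (r, c) \<noteq> (s, d))
    (filter (\<lambda>(c, d). c \<noteq> d) (List.product [1..<7] [1..<7]))"
  by (auto simp: skew_columns_def intro!: filter_cong)

lemmas skew_columns_eval = skew_columns_split[simplified upt_eval, simplified]

lemma line_paths_correct:
  "list_all (\<lambda>((r, s), pss).
     list_all2 (\<lambda>(c, d) ms. reaches_line (\<lambda>_. True) partner ms (r, c) (s, d)) (skew_columns r s) pss)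
     line_paths"
  unfolding line_paths_def list.pred_inject prod.case
  by (intro conjI TrueI) (simp_all add: skew_columns_eval partner_table)

lemma funpow_map_prod:
  fixes f :: "'a \<Rightarrow> 'a" and g :: "'b \<Rightarrow> 'b"
  shows "(map_prod f g ^^ k) (x, y) = ((f ^^ k) x, (g ^^ k) y)"
  by (induction k) auto

lemma funpow_rot_in: "a \<in> cells 15 6 \<Longrightarrow> (rot ^^ k) a \<in> cells 15 6"
  by (induction k) (simp_all add: rot_in)

lemma partner_funpow_rot: "a \<in> cells 15 6 \<Longrightarrow> partner ((rot ^^ k) a) = (rot ^^ k) (partner a)"
  by (induction k) (simp_all add: partner_rot funpow_rot_in)

lemma bij_rot_row: "bij_betw rot_row {1..15} {1..15}"
  unfolding bij_betw_def
proof (intro conjI inj_rot_row endo_inj_surj)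
  show "rot_row ` {1..15} \<subseteq> {1..15}" by (auto simp: rot_row_def; presburger)
qed simp

lemma bij_rot_col: "bij_betw rot_col {1..6} {1..6}"
  unfolding bij_betw_def
proof (intro conjI inj_rot_col endo_inj_surj)
  show "rot_col ` {1..6} \<subseteq> {1..6}" by (auto simp: rot_col_def)
qed simp

lemmas bij_funpow_rot_row = bij_betw_funpow[OF bij_rot_row]
lemmas bij_funpow_rot_col = bij_betw_funpow[OF bij_rot_col]

lemma reaches_line_funpow_rot:
  assumes "reaches_line glue partner ms a b" "a \<in> cells 15 6" "b \<in> cells 15 6"
    and "\<And>a. \<lbrakk>a \<in> cells 15 6; glue a\<rbrakk> \<Longrightarrow> glue (rot a)"
  shows "reaches_line glue partner ms ((rot ^^ k) a) ((rot ^^ k) b)"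
proof (induction k)
  case (Suc k)
  then show ?case
    using reaches_line_equivariant[OF Suc _ _ inj_rot_row inj_rot_col, folded cells_def,
        OF funpow_rot_in[OF assms(2)] funpow_rot_in[OF assms(3)] partner_in partner_rot assms(4)]
    by simp
qed (use assms(1) in simp)

definition row_pairs :: "(nat \<times> nat) list" where
  "row_pairs = map fst line_paths"

lemmas row_pairs_eval = row_pairs_def[unfolded line_paths_def list.map fst_conv]

definition row_orbit_pairs :: "(nat \<times> nat) list" where
  "row_orbit_pairs =
     concat (map (\<lambda>k. map (map_prod (rot_row ^^ k) (rot_row ^^ k)) row_pairs) [0, 1, 2, 3, 4])"

lemma funpow_numerals:
  fixes f :: "'a \<Rightarrow> 'a"
  shows "(f ^^ 1) x = f x" "(f ^^ 2) x = f (f x)" "(f ^^ 3) x = f (f (f x))"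
    "(f ^^ 4) x = f (f (f (f x)))"
  by (simp_all add: numeral_eq_Suc One_nat_def)

lemmas row_orbit_pairs_eval =
  row_orbit_pairs_def[unfolded row_pairs_eval, simplified,
    simplified funpow_numerals rot_row_def, simplified]

lemma upt_1_16: "[1..<16] = [1, 2, 3, 4, 5, 6, 7, 8, 9, 10, 11, 12, 13, 14, 15]"
  by (simp add: upt_eval)

text \<open>The five rotations of the 21 representatives are \<open>105 = 15 choose 2\<close> pairs, one for each unordered
  pair of rows.\<close>

lemma row_pairs_cover:
  assumes "r \<in> {1..15}" "s \<in> {1..15}" "r \<noteq> s"
  shows "(r, s) \<in> set row_orbit_pairs \<or> (s, r) \<in> set row_orbit_pairs"
proof -
  have "list_all (\<lambda>r. list_all (\<lambda>s. r = s \<or> (r, s) \<in> set row_orbit_pairs \<or>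
      (s, r) \<in> set row_orbit_pairs) [1..<16]) [1..<16]"
    unfolding upt_1_16 list.pred_inject by (simp add: row_orbit_pairs_eval)
  moreover have "r \<in> set [1..<16]" "s \<in> set [1..<16]" using assms by auto
  ultimately show ?thesis using assms(3) unfolding list_all_iff by blast
qed

lemma reaches_line_row_pairs:
  assumes "(r, s) \<in> set row_pairs" "c \<in> {1..6}" "d \<in> {1..6}" "c \<noteq> d" "partner (r, c) \<noteq> (s, d)"
  shows "\<exists>ms. reaches_line (\<lambda>_. True) partner ms (r, c) (s, d)"
proof -
  from assms(1) obtain pss where "((r, s), pss) \<in> set line_paths" by (auto simp: row_pairs_def)
  then have all2: "list_all2 (\<lambda>(c, d) ms. reaches_line (\<lambda>_. True) partner ms (r, c) (s, d)) (skew_columns r s) pss"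
    using bspec[OF line_paths_correct[unfolded list_all_iff], of "((r, s), pss)"] by simp
  have "(c, d) \<in> set (skew_columns r s)" using assms by (simp add: skew_columns_def)
  then obtain i where "i < length (skew_columns r s)" "skew_columns r s ! i = (c, d)"
    by (auto simp: in_set_conv_nth)
  with list_all2_nthD[OF all2, of i] show ?thesis by auto
qed

lemma row_pairs_in: "list_all (\<lambda>(r, s). r \<in> {1..15} \<and> s \<in> {1..15}) row_pairs"
  by (simp add: row_pairs_def line_paths_def)

text \<open>Once the rows are rotated back to a representative pair, the columns may be arbitrary, because
  the rotation permutes the columns and the table covers all of them.\<close>

lemma reaches_line_if_rows_covered:
  assumes "(r', s') \<in> set row_pairs" "fst a = (rot_row ^^ k) r'" "fst b = (rot_row ^^ k) s'"
    and ab: "a \<in> cells 15 6" "b \<in> cells 15 6" "snd a \<noteq> snd b" "partner a \<noteq> b"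
  shows "\<exists>ms. reaches_line (\<lambda>_. True) partner ms a b"
proof -
  have "snd a \<in> {1..6}" "snd b \<in> {1..6}" using ab by (auto simp: cells_def)
  then have "snd a \<in> (rot_col ^^ k) ` {1..6}" "snd b \<in> (rot_col ^^ k) ` {1..6}"
    by (simp_all only: bij_betw_imp_surj_on[OF bij_funpow_rot_col])
  then obtain c d where cd: "c \<in> {1..6}" "snd a = (rot_col ^^ k) c" "d \<in> {1..6}" "snd b = (rot_col ^^ k) d"
    by (elim imageE)
  have a: "a = (rot ^^ k) (r', c)" and b: "b = (rot ^^ k) (s', d)"
    using assms(2,3) cd by (simp_all add: funpow_map_prod prod_eq_iff)
  have in_cells: "(r', c) \<in> cells 15 6" "(s', d) \<in> cells 15 6"
    using bspec[OF row_pairs_in[unfolded list_all_iff] assms(1)] cd by (simp_all add: cells_def)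
  have "c \<noteq> d" using ab(3) cd by auto
  moreover have "partner (r', c) \<noteq> (s', d)"
    using ab(4) partner_funpow_rot[OF in_cells(1), of k] by (auto simp: a b)
  ultimately obtain ms where "reaches_line (\<lambda>_. True) partner ms (r', c) (s', d)"
    using reaches_line_row_pairs[OF assms(1) cd(1,3)] by blast
  then have "reaches_line (\<lambda>_. True) partner ms a b"
    unfolding a b by (rule reaches_line_funpow_rot) (use in_cells in simp_all)
  then show ?thesis ..
qed

lemma reaches_line_all:
  assumes ab: "a \<in> cells 15 6" "b \<in> cells 15 6" "fst a \<noteq> fst b" "snd a \<noteq> snd b" "partner a \<noteq> b"
  shows "\<exists>ms. reaches_line (\<lambda>_. True) partner ms a b \<or> reaches_line (\<lambda>_. True) partner ms b a"
proof -
  have rows: "fst a \<in> {1..15}" "fst b \<in> {1..15}" using ab by (auto simp: cells_def)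
  have "\<exists>k r s. (r, s) \<in> set row_pairs \<and> x = (rot_row ^^ k) r \<and> y = (rot_row ^^ k) s"
    if "(x, y) \<in> set row_orbit_pairs" for x y
  proof -
    have "\<exists>k. p \<in> set (f k)" if "p \<in> set (concat (map f ks))" for p f and ks :: "nat list"
      using that by auto
    from this[OF that[unfolded row_orbit_pairs_def]] show ?thesis by force
  qed
  with row_pairs_cover[OF rows ab(3)] obtain k r s where rs: "(r, s) \<in> set row_pairs"
    and "(fst a = (rot_row ^^ k) r \<and> fst b = (rot_row ^^ k) s) \<or>
      (fst b = (rot_row ^^ k) r \<and> fst a = (rot_row ^^ k) s)"
    by blast
  then consider "fst a = (rot_row ^^ k) r" "fst b = (rot_row ^^ k) s"
    | "fst b = (rot_row ^^ k) r" "fst a = (rot_row ^^ k) s" by blast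
  then show ?thesis
  proof cases
    case 1
    from reaches_line_if_rows_covered[OF rs this ab(1,2,4,5)] show ?thesis by auto
  next
    case 2
    have "partner b \<noteq> a" using ab partner_partner[OF ab(2)] by auto
    with reaches_line_if_rows_covered[OF rs 2 ab(2,1)] ab(4) show ?thesis by auto
  qed
qed

section \<open>Identification of the two-edges\<close>

definition degenerate :: "cell \<Rightarrow> bool" where
  "degenerate a \<longleftrightarrow> fst (partner a) = fst a \<or> snd (partner a) = snd a"

lemma degenerate_rot: "\<lbrakk>a \<in> cells 15 6; degenerate a\<rbrakk> \<Longrightarrow> degenerate (rot a)"
  by (auto simp: degenerate_def partner_rot)

lemma identified_degenerate:
  assumes "a \<in> cells 15 6" "degenerate a" "partner a \<noteq> a"
  shows "identified signed 15 6 grid.ones grid.doubles {a, partner a}"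
proof (rule line_identified)
  show "{a, partner a} \<in> grid.doubles"
    using assms by (simp add: grid.pair_in_doubles_iff)
qed (use assms partner_in in \<open>auto simp: degenerate_def\<close>)

text \<open>The diagonal two-edges are the rotations of \<open>{(1, 4), (14, 6)}\<close>, by the orbit
  \<open>(cell_at 0 i 3, cell_at 2 (i + 3) 5)\<close>. The path starts from the opposite diagonal and glues
  along degenerate two-edges only, so it certifies that diagonal before any diagonal two-edge is
  identified. Rectangle transfer then identifies the two-edge.\<close>

lemma identified_diagonal:
  "identified signed 15 6 grid.ones grid.doubles {(rot ^^ k) (1, 4), (rot ^^ k) (14, 6)}"
proof -
  have "reaches_line degenerate partner
      [R,S,R,S,R,L,S,R,S,L,S,R,S,L,S,L,S,L,S,R,S,L,S,R,L] (1, 6) (14, 4)"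
    by (simp add: degenerate_def partner_table)
  then obtain ms where reach: "reaches_line degenerate partner ms (1, 6) (14, 4)" ..
  have in_cells: "(1, 4) \<in> cells 15 6" "(14, 6) \<in> cells 15 6" "(1, 6) \<in> cells 15 6" "(14, 4) \<in> cells 15 6"
    by (simp_all add: cells_def)
  define r s c d where "r = (rot_row ^^ k) 1" and "s = (rot_row ^^ k) 14"
    and "c = (rot_col ^^ k) 4" and "d = (rot_col ^^ k) 6"
  have rsin: "r \<in> {1..15}" "s \<in> {1..15}" "c \<in> {1..6}" "d \<in> {1..6}"
    using bij_betwE[OF bij_funpow_rot_row[of k]] bij_betwE[OF bij_funpow_rot_col[of k]]
    by (simp_all add: r_def s_def c_def d_def)
  have neq: "r \<noteq> s" "c \<noteq> d"
    using bij_funpow_rot_row[of k] bij_funpow_rot_col[of k]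
    by (auto simp: r_def s_def c_def d_def bij_betw_def inj_on_eq_iff)
  have rot: "(rot ^^ k) (1, 4) = (r, c)" "(rot ^^ k) (14, 6) = (s, d)"
    "(rot ^^ k) (1, 6) = (r, d)" "(rot ^^ k) (14, 4) = (s, c)"
    by (simp_all add: funpow_map_prod r_def s_def c_def d_def)
  have opp: "opposite_diagonals 15 6 {(r, c), (s, d)} {(r, d), (s, c)}"
    unfolding opposite_diagonals_def
    by (rule bexI[of _ r], rule bexI[of _ s], rule bexI[of _ c], rule bexI[of _ d])
      (use rsin neq in simp_all)
  have "partner (r, c) = (s, d)"
    using partner_funpow_rot[OF in_cells(1), of k] by (simp add: partner_table rot)
  moreover have partner_d: "partner (r, d) = (r, d)"
    using partner_funpow_rot[OF in_cells(3), of k] by (simp add: partner_table rot)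
  moreover have rect_in: "(r, c) \<in> cells 15 6" "(r, d) \<in> cells 15 6" "(s, c) \<in> cells 15 6"
    using rsin by (simp_all add: cells_def)
  moreover have "certified signed 15 6 grid.ones grid.doubles {(r, d), (s, c)}"
  proof (rule grid.certified_if_reaches_line[of degenerate])
    show "reaches_line degenerate partner ms (r, d) (s, c)"
      using reaches_line_funpow_rot[OF reach in_cells(3,4) degenerate_rot, of k] by (simp only: rot)
  qed (use rect_in neq in \<open>simp_all add: identified_degenerate\<close>)
  ultimately show ?thesis
    unfolding rot by (intro transfer_identified[OF opp]) (use neq in \<open>simp_all add: grid.pair_in_doubles_iff\<close>)
qed

lemma nondegenerate:
  assumes "a \<in> cells 15 6" "\<not> degenerate a"
  shows "\<exists>k. a = (rot ^^ k) (1, 4) \<or> a = (rot ^^ k) (14, 6)"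
proof -
  have "\<forall>a \<in> cells 15 6. degenerate a \<or>
      list_ex (\<lambda>k. a = (rot ^^ k) (1, 4) \<or> a = (rot ^^ k) (14, 6)) [0, 1, 2, 3, 4]"
    unfolding ball_cells_iff cell_list_eval list.pred_inject
    by (simp add: degenerate_def partner_table funpow_numerals rot_row_def rot_col_def flip: One_nat_def)
  then show ?thesis using assms unfolding list_ex_iff by blast
qed

lemma identified_all:
  assumes "a \<in> cells 15 6" "partner a \<noteq> a"
  shows "identified signed 15 6 grid.ones grid.doubles {a, partner a}"
proof (cases "degenerate a")
  case False
  obtain k where "a = (rot ^^ k) (1, 4) \<or> a = (rot ^^ k) (14, 6)"
    using nondegenerate[OF assms(1) False] by blast
  moreover have "partner ((rot ^^ k) (1, 4)) = (rot ^^ k) (14, 6)"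
    "partner ((rot ^^ k) (14, 6)) = (rot ^^ k) (1, 4)"
    by (simp_all add: partner_funpow_rot cells_def partner_table)
  ultimately show ?thesis
    using identified_diagonal[of signed k] by (auto simp: insert_commute)
qed (use assms identified_degenerate in blast)

lemma grid_satisfies_RW3: "satisfies_RW3 signed 15 6 grid.ones grid.doubles"
  by (rule grid.satisfies_RW3_if) (rule identified_all reaches_line_all; assumption)+

section \<open>The two maxima\<close>

lemma Max_total:
  "Max {card E1 + card E2 |E1 E2. simple_grid 15 6 E1 E2 \<and> limited_grid 15 6 E1 \<and>
     satisfies_RW3 signed 15 6 E1 E2} = 60"
proof (rule Max_eqI[OF finite_totals])
  fix y
  assume "y \<in> {card E1 + card E2 |E1 E2. simple_grid 15 6 E1 E2 \<and> limited_grid 15 6 E1 \<and>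
     satisfies_RW3 signed 15 6 E1 E2}"
  then obtain E1 E2 where "y = card E1 + card E2" "simple_grid 15 6 E1 E2" "card E1 = 30"
    by (auto simp: limited_grid_def zarankiewicz_15_6)
  then show "y \<le> 60" using simple_grid_card_le[of 15 6 E1 E2] by simp
next
  have "card grid.doubles = 30" using grid.card_ones_doubles by (simp add: card_ones)
  then show "60 \<in> {card E1 + card E2 |E1 E2. simple_grid 15 6 E1 E2 \<and> limited_grid 15 6 E1 \<and>
     satisfies_RW3 signed 15 6 E1 E2}"
    using grid.is_simple_grid grid_satisfies_RW3[of signed] card_ones
    by (intro CollectI exI[of _ grid.ones] exI[of _ grid.doubles])
      (simp add: limited_grid_def zarankiewicz_15_6)
qed

theorem corollary3p2: "z_SL 15 6 = 60 \<and> z_RL 15 6 = 60"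
  by (simp add: z_SL_def z_RL_def Max_total)

end
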